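(* Let $R$ be an integral domain which is not a field, with quotient field $K$. Then the following statements are equivalent. (1) $GD(R)$ is compact. (2) There exists $a\in R^\#$ such that $B_a=EC(R^\#)$. (3) $\displaystyle\bigcap_{\substack{P\in\operatorname{Spec}(R)\\ P\neq(0)}}P\neq(0)$. (4) $K$ is finitely generated as an $R$-algebra; equivalently, $R$ is a $G$-domain.
   Context: For a commutative ring $R$ with nonzero identity and unit group $U(R)$, let $R^\#=R\setminus(U(R)\cup\{0\})$ be the set of nonzero nonunits. For $a,b\in R^\#$ write $a\sim b$ if $aR=bR$; $[a]$ denotes the equivalence class of $a$ and $EC(R^\#)$ the set of equivalence classes. For $a\in R^\#$ put $B_a=\{[b]\in EC(R^\#): b\mid a^n\text{ for some }n\geq 1\}$. The sets $B_a$ ($a\in R^\#$) form a basis of a topology on $EC(R^\#)$; the resulting space is denoted $GD(R)$ (the generalized divisor topology). A nonfield integral domain $R$ with quotient field $K$ is called a $G$-domain if $K$ is finitely generated as an $R$-algebra. Compact means every open cover has a finite subcover (no separation axiom assumed). *)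

theory Defs
  imports "HOL-Analysis.Abstract_Topology" "HOL-Algebra.Algebra"
begin

section \<open>The generalized divisor topology\<close>

definition nonzero_nonunits :: "('a, 'm) ring_scheme \<Rightarrow> 'a set" where
  "nonzero_nonunits R = carrier R - (Units R \<union> {\<zero>\<^bsub>R\<^esub>})"

text \<open>\<open>PIdl\<^bsub>R\<^esub> a\<close> is the set \<open>aR\<close> of all multiples of \<open>a\<close>.\<close>

definition same_ideal_rel :: "('a, 'm) ring_scheme \<Rightarrow> ('a \<times> 'a) set" where
  "same_ideal_rel R =
     {(a, b). a \<in> nonzero_nonunits R \<and> b \<in> nonzero_nonunits R \<and> PIdl\<^bsub>R\<^esub> a = PIdl\<^bsub>R\<^esub> b}"

definition ideal_class :: "('a, 'm) ring_scheme \<Rightarrow> 'a \<Rightarrow> 'a set" where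
  "ideal_class R a = same_ideal_rel R `` {a}"

definition EC :: "('a, 'm) ring_scheme \<Rightarrow> 'a set set" where
  "EC R = nonzero_nonunits R // same_ideal_rel R"

definition GD_basic :: "('a, 'm) ring_scheme \<Rightarrow> 'a \<Rightarrow> 'a set set" where
  "GD_basic R a =
     {ideal_class R b | b. b \<in> nonzero_nonunits R \<and>
        (\<exists>n::nat. n \<ge> 1 \<and> b divides\<^bsub>R\<^esub> (a [^]\<^bsub>R\<^esub> n))}"

definition GD :: "('a, 'm) ring_scheme \<Rightarrow> 'a set topology" where
  "GD R = topology (arbitrary union_of (\<lambda>B. B \<in> GD_basic R ` nonzero_nonunits R))"

section \<open>Quotient fields and G-domains\<close>

text \<open>A quotient field of \<open>R\<close> is given up to isomorphism, as a field \<open>K\<close> with an embedding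
  \<open>\<iota>\<close> of \<open>R\<close> such that every element of \<open>K\<close> is a fraction.\<close>

definition is_quotient_field ::
  "('a, 'm) ring_scheme \<Rightarrow> ('k, 'n) ring_scheme \<Rightarrow> ('a \<Rightarrow> 'k) \<Rightarrow> bool" where
  "is_quotient_field R K \<iota> \<longleftrightarrow>
     domain R \<and> field K \<and> \<iota> \<in> ring_hom R K \<and> inj_on \<iota> (carrier R) \<and>
     (\<forall>x \<in> carrier K. \<exists>a \<in> carrier R. \<exists>b \<in> carrier R - {\<zero>\<^bsub>R\<^esub>}.
        x = \<iota> a \<otimes>\<^bsub>K\<^esub> inv\<^bsub>K\<^esub> (\<iota> b))"

text \<open>The \<open>R\<close>-subalgebra of \<open>K\<close> generated by \<open>S\<close> is the subring generated by
  \<open>S\<close> and the image of \<open>R\<close>.\<close>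

definition finitely_generated_algebra ::
  "('a, 'm) ring_scheme \<Rightarrow> ('k, 'n) ring_scheme \<Rightarrow> ('a \<Rightarrow> 'k) \<Rightarrow> bool" where
  "finitely_generated_algebra R K \<iota> \<longleftrightarrow>
     (\<exists>S. finite S \<and> S \<subseteq> carrier K \<and> generate_ring K (\<iota> ` carrier R \<union> S) = carrier K)"

text \<open>The standard model of the quotient field: classes of pairs \<open>(a, b)\<close> with \<open>b \<noteq> 0\<close>.
  It satisfies \<open>is_quotient_field\<close>; see \<open>quot_field_is_quotient_field\<close> below.\<close>

definition fraction_rel :: "('a, 'm) ring_scheme \<Rightarrow> (('a \<times> 'a) \<times> ('a \<times> 'a)) set" where
  "fraction_rel R =
     {((a, b), (c, d)). a \<in> carrier R \<and> b \<in> carrier R - {\<zero>\<^bsub>R\<^esub>} \<and>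
        c \<in> carrier R \<and> d \<in> carrier R - {\<zero>\<^bsub>R\<^esub>} \<and> a \<otimes>\<^bsub>R\<^esub> d = c \<otimes>\<^bsub>R\<^esub> b}"

definition fraction :: "('a, 'm) ring_scheme \<Rightarrow> 'a \<Rightarrow> 'a \<Rightarrow> ('a \<times> 'a) set" where
  "fraction R a b = fraction_rel R `` {(a, b)}"

text \<open>The unions below are over representatives; all their members coincide.\<close>

definition quot_field :: "('a, 'm) ring_scheme \<Rightarrow> ('a \<times> 'a) set ring" where
  "quot_field R =
     \<lparr>carrier = {fraction R a b | a b. a \<in> carrier R \<and> b \<in> carrier R - {\<zero>\<^bsub>R\<^esub>}},
      monoid.mult = (\<lambda>U V. \<Union>p\<in>U. \<Union>q\<in>V. fraction R (fst p \<otimes>\<^bsub>R\<^esub> fst q) (snd p \<otimes>\<^bsub>R\<^esub> snd q)),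
      one = fraction R \<one>\<^bsub>R\<^esub> \<one>\<^bsub>R\<^esub>,
      ring.zero = fraction R \<zero>\<^bsub>R\<^esub> \<one>\<^bsub>R\<^esub>,
      ring.add = (\<lambda>U V. \<Union>p\<in>U. \<Union>q\<in>V.
               fraction R (fst p \<otimes>\<^bsub>R\<^esub> snd q \<oplus>\<^bsub>R\<^esub> fst q \<otimes>\<^bsub>R\<^esub> snd p) (snd p \<otimes>\<^bsub>R\<^esub> snd q))\<rparr>"

definition quot_embedding :: "('a, 'm) ring_scheme \<Rightarrow> 'a \<Rightarrow> ('a \<times> 'a) set" where
  "quot_embedding R a = fraction R a \<one>\<^bsub>R\<^esub>"

definition G_domain :: "('a, 'm) ring_scheme \<Rightarrow> bool" where
  "G_domain R \<longleftrightarrow> domain R \<and> \<not> field R \<and>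
     finitely_generated_algebra R (quot_field R) (quot_embedding R)"

section \<open>Well-definedness\<close>

lemma UN_UN_const:
  assumes "x \<in> A" "y \<in> B" "\<And>p q. p \<in> A \<Longrightarrow> q \<in> B \<Longrightarrow> f p q = Z"
  shows "(\<Union>p\<in>A. \<Union>q\<in>B. f p q) = Z"
  using assms by auto

context domain
begin

lemma fraction_eq_iff:
  assumes "a \<in> carrier R" "b \<in> carrier R - {\<zero>}" "c \<in> carrier R" "d \<in> carrier R - {\<zero>}"
  shows "fraction R a b = fraction R c d \<longleftrightarrow> a \<otimes> d = c \<otimes> b"
proof
  assume "fraction R a b = fraction R c d"
  moreover have "(c, d) \<in> fraction R c d"
    using assms by (simp add: fraction_def fraction_rel_def)
  ultimately have "(c, d) \<in> fraction R a b" by simp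
  then show "a \<otimes> d = c \<otimes> b" by (simp add: fraction_def fraction_rel_def)
next
  assume eq: "a \<otimes> d = c \<otimes> b"
  have tr: "p \<otimes> v = u \<otimes> q"
    if "p \<otimes> s = r \<otimes> q" "r \<otimes> v = u \<otimes> s"
      "p \<in> carrier R" "q \<in> carrier R - {\<zero>}" "r \<in> carrier R" "s \<in> carrier R - {\<zero>}"
      "u \<in> carrier R" "v \<in> carrier R" for p q r s u v
  proof -
    have "s \<otimes> (p \<otimes> v) = (p \<otimes> s) \<otimes> v" using that(3-) by (simp add: m_ac)
    also have "\<dots> = (r \<otimes> q) \<otimes> v" using that(1) by simp
    also have "\<dots> = q \<otimes> (r \<otimes> v)" using that(3-) by (simp add: m_ac)
    also have "\<dots> = q \<otimes> (u \<otimes> s)" using that(2) by simp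
    also have "\<dots> = s \<otimes> (u \<otimes> q)" using that(3-) by (simp add: m_ac)
    finally show ?thesis using that(3-) m_lcancel[of s "p \<otimes> v" "u \<otimes> q"] by simp
  qed
  have "a \<otimes> v = u \<otimes> b \<longleftrightarrow> c \<otimes> v = u \<otimes> d" if "u \<in> carrier R" "v \<in> carrier R" for u v
    using tr[of c b a d v u] tr[of a d c b v u] eq[symmetric] assms that by metis
  then show "fraction R a b = fraction R c d"
    using assms by (auto simp: fraction_def fraction_rel_def)
qed

lemma fraction_mem: "(c, d) \<in> fraction R a b \<longleftrightarrow>
    a \<in> carrier R \<and> b \<in> carrier R - {\<zero>} \<and> c \<in> carrier R \<and> d \<in> carrier R - {\<zero>} \<and> a \<otimes> d = c \<otimes> b"
  by (simp add: fraction_def fraction_rel_def)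

lemma quot_mult:
  assumes "a \<in> carrier R" "b \<in> carrier R - {\<zero>}" "c \<in> carrier R" "d \<in> carrier R - {\<zero>}"
  shows "fraction R a b \<otimes>\<^bsub>quot_field R\<^esub> fraction R c d = fraction R (a \<otimes> c) (b \<otimes> d)"
proof -
  have wd: "fraction R (a' \<otimes> c') (b' \<otimes> d') = fraction R (a \<otimes> c) (b \<otimes> d)"
    if "(a', b') \<in> fraction R a b" "(c', d') \<in> fraction R c d" for a' b' c' d'
  proof -
    have eqs: "a \<otimes> b' = a' \<otimes> b" "c \<otimes> d' = c' \<otimes> d" using that by (auto simp: fraction_mem)
    have cs: "a' \<in> carrier R" "b' \<in> carrier R - {\<zero>}" "c' \<in> carrier R" "d' \<in> carrier R - {\<zero>}"
      using that by (auto simp: fraction_mem)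
    have "(a' \<otimes> c') \<otimes> (b \<otimes> d) = (a' \<otimes> b) \<otimes> (c' \<otimes> d)" using assms cs by (simp add: m_ac)
    also have "\<dots> = (a \<otimes> b') \<otimes> (c \<otimes> d')" using eqs by simp
    also have "\<dots> = (a \<otimes> c) \<otimes> (b' \<otimes> d')" using assms cs by (simp add: m_ac)
    finally show ?thesis using assms cs by (subst fraction_eq_iff) (auto simp: integral_iff)
  qed
  have mem: "(a, b) \<in> fraction R a b" "(c, d) \<in> fraction R c d"
    using assms by (auto simp: fraction_mem)
  show ?thesis
    unfolding quot_field_def monoid.simps ring.simps
  proof (rule UN_UN_const[OF mem])
    fix p q assume "p \<in> fraction R a b" "q \<in> fraction R c d"
    then show "fraction R (fst p \<otimes> fst q) (snd p \<otimes> snd q) = fraction R (a \<otimes> c) (b \<otimes> d)"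
      using wd[of "fst p" "snd p" "fst q" "snd q"] by simp
  qed
qed

lemma quot_add:
  assumes "a \<in> carrier R" "b \<in> carrier R - {\<zero>}" "c \<in> carrier R" "d \<in> carrier R - {\<zero>}"
  shows "fraction R a b \<oplus>\<^bsub>quot_field R\<^esub> fraction R c d =
    fraction R (a \<otimes> d \<oplus> c \<otimes> b) (b \<otimes> d)"
proof -
  have wd: "fraction R (a' \<otimes> d' \<oplus> c' \<otimes> b') (b' \<otimes> d') = fraction R (a \<otimes> d \<oplus> c \<otimes> b) (b \<otimes> d)"
    if "(a', b') \<in> fraction R a b" "(c', d') \<in> fraction R c d" for a' b' c' d'
  proof -
    have eqs: "a \<otimes> b' = a' \<otimes> b" "c \<otimes> d' = c' \<otimes> d" using that by (auto simp: fraction_mem)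
    have cs: "a' \<in> carrier R" "b' \<in> carrier R - {\<zero>}" "c' \<in> carrier R" "d' \<in> carrier R - {\<zero>}"
      using that by (auto simp: fraction_mem)
    have "(a' \<otimes> d' \<oplus> c' \<otimes> b') \<otimes> (b \<otimes> d) =
        (a' \<otimes> b) \<otimes> (d \<otimes> d') \<oplus> (c' \<otimes> d) \<otimes> (b \<otimes> b')"
      using assms cs by (simp add: m_ac l_distr r_distr)
    also have "\<dots> = (a \<otimes> b') \<otimes> (d \<otimes> d') \<oplus> (c \<otimes> d') \<otimes> (b \<otimes> b')" using eqs by simp
    also have "\<dots> = (a \<otimes> d \<oplus> c \<otimes> b) \<otimes> (b' \<otimes> d')"
      using assms cs by (simp add: m_ac l_distr r_distr)
    finally show ?thesis using assms cs by (subst fraction_eq_iff) (auto simp: integral_iff)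
  qed
  have mem: "(a, b) \<in> fraction R a b" "(c, d) \<in> fraction R c d"
    using assms by (auto simp: fraction_mem)
  show ?thesis
    unfolding quot_field_def monoid.simps ring.simps
  proof (rule UN_UN_const[OF mem])
    fix p q assume "p \<in> fraction R a b" "q \<in> fraction R c d"
    then show "fraction R (fst p \<otimes> snd q \<oplus> fst q \<otimes> snd p) (snd p \<otimes> snd q) = fraction R (a \<otimes> d \<oplus> c \<otimes> b) (b \<otimes> d)"
      using wd[of "fst p" "snd p" "fst q" "snd q"] by simp
  qed
qed

lemma quot_carrierI:
  "a \<in> carrier R \<Longrightarrow> b \<in> carrier R - {\<zero>} \<Longrightarrow> fraction R a b \<in> carrier (quot_field R)"
  by (auto simp: quot_field_def)

lemma quot_carrierE:
  assumes "x \<in> carrier (quot_field R)"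
  obtains a b where "a \<in> carrier R" "b \<in> carrier R" "b \<noteq> \<zero>" "x = fraction R a b"
  using assms by (auto simp: quot_field_def)

lemma quot_zero: "\<zero>\<^bsub>quot_field R\<^esub> = fraction R \<zero> \<one>"
  and quot_one: "\<one>\<^bsub>quot_field R\<^esub> = fraction R \<one> \<one>"
  by (simp_all add: quot_field_def)

lemma quot_cring: "cring (quot_field R)"
proof (rule cringI)
  note s = quot_mult quot_add quot_zero quot_one fraction_eq_iff integral_iff
  show "abelian_group (quot_field R)"
  proof (rule abelian_groupI)
    show "x \<oplus>\<^bsub>quot_field R\<^esub> y \<in> carrier (quot_field R)"
      if "x \<in> carrier (quot_field R)" "y \<in> carrier (quot_field R)" for x y
      using that by (elim quot_carrierE) (auto simp: s intro!: quot_carrierI)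
    show "\<zero>\<^bsub>quot_field R\<^esub> \<in> carrier (quot_field R)"
      by (auto simp: s intro!: quot_carrierI)
    show "x \<oplus>\<^bsub>quot_field R\<^esub> y \<oplus>\<^bsub>quot_field R\<^esub> z =
        x \<oplus>\<^bsub>quot_field R\<^esub> (y \<oplus>\<^bsub>quot_field R\<^esub> z)"
      if "x \<in> carrier (quot_field R)" "y \<in> carrier (quot_field R)" "z \<in> carrier (quot_field R)"
      for x y z
      using that by (elim quot_carrierE) (simp add: quot_mult quot_add integral_iff m_ac a_ac l_distr r_distr)
    show "x \<oplus>\<^bsub>quot_field R\<^esub> y = y \<oplus>\<^bsub>quot_field R\<^esub> x"
      if "x \<in> carrier (quot_field R)" "y \<in> carrier (quot_field R)" for x y
      using that by (elim quot_carrierE) (simp add: quot_mult quot_add integral_iff m_ac a_ac l_distr r_distr)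
    show "\<zero>\<^bsub>quot_field R\<^esub> \<oplus>\<^bsub>quot_field R\<^esub> x = x" if "x \<in> carrier (quot_field R)" for x
      using that by (elim quot_carrierE) (simp add: s)
    show "\<exists>y\<in>carrier (quot_field R). y \<oplus>\<^bsub>quot_field R\<^esub> x = \<zero>\<^bsub>quot_field R\<^esub>"
      if "x \<in> carrier (quot_field R)" for x
    proof -
      obtain a b where ab: "a \<in> carrier R" "b \<in> carrier R" "b \<noteq> \<zero>" "x = fraction R a b"
        using \<open>x \<in> carrier (quot_field R)\<close> quot_carrierE by metis
      then have "fraction R (\<ominus> a) b \<oplus>\<^bsub>quot_field R\<^esub> x = \<zero>\<^bsub>quot_field R\<^esub>"
        by (simp add: s l_minus l_neg)
      then show ?thesis using ab quot_carrierI[of "\<ominus> a" b] by blast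
    qed
  qed
  show "comm_monoid (quot_field R)"
  proof (rule comm_monoidI)
    show "x \<otimes>\<^bsub>quot_field R\<^esub> y \<in> carrier (quot_field R)"
      if "x \<in> carrier (quot_field R)" "y \<in> carrier (quot_field R)" for x y
      using that by (elim quot_carrierE) (auto simp: s intro!: quot_carrierI)
    show "\<one>\<^bsub>quot_field R\<^esub> \<in> carrier (quot_field R)"
      by (auto simp: s intro!: quot_carrierI)
    show "x \<otimes>\<^bsub>quot_field R\<^esub> y \<otimes>\<^bsub>quot_field R\<^esub> z =
        x \<otimes>\<^bsub>quot_field R\<^esub> (y \<otimes>\<^bsub>quot_field R\<^esub> z)"
      if "x \<in> carrier (quot_field R)" "y \<in> carrier (quot_field R)" "z \<in> carrier (quot_field R)"
      for x y z
      using that by (elim quot_carrierE) (simp add: quot_mult integral_iff m_ac)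
    show "\<one>\<^bsub>quot_field R\<^esub> \<otimes>\<^bsub>quot_field R\<^esub> x = x" if "x \<in> carrier (quot_field R)" for x
      using that by (elim quot_carrierE) (simp add: s)
    show "x \<otimes>\<^bsub>quot_field R\<^esub> y = y \<otimes>\<^bsub>quot_field R\<^esub> x"
      if "x \<in> carrier (quot_field R)" "y \<in> carrier (quot_field R)" for x y
      using that by (elim quot_carrierE) (simp add: quot_mult integral_iff m_ac)
  qed
  show "(x \<oplus>\<^bsub>quot_field R\<^esub> y) \<otimes>\<^bsub>quot_field R\<^esub> z =
      x \<otimes>\<^bsub>quot_field R\<^esub> z \<oplus>\<^bsub>quot_field R\<^esub> y \<otimes>\<^bsub>quot_field R\<^esub> z"
    if "x \<in> carrier (quot_field R)" "y \<in> carrier (quot_field R)" "z \<in> carrier (quot_field R)"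
    for x y z
  proof -
    obtain a b where x: "a \<in> carrier R" "b \<in> carrier R" "b \<noteq> \<zero>" "x = fraction R a b"
      using \<open>x \<in> carrier (quot_field R)\<close> quot_carrierE by metis
    obtain c d where y: "c \<in> carrier R" "d \<in> carrier R" "d \<noteq> \<zero>" "y = fraction R c d"
      using \<open>y \<in> carrier (quot_field R)\<close> quot_carrierE by metis
    obtain e f where z: "e \<in> carrier R" "f \<in> carrier R" "f \<noteq> \<zero>" "z = fraction R e f"
      using \<open>z \<in> carrier (quot_field R)\<close> quot_carrierE by metis
    have "(x \<oplus>\<^bsub>quot_field R\<^esub> y) \<otimes>\<^bsub>quot_field R\<^esub> z = fraction R ((a \<otimes> d \<oplus> c \<otimes> b) \<otimes> e) (b \<otimes> d \<otimes> f)"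
      using x y z by (simp add: quot_mult quot_add integral_iff)
    also have "\<dots> = fraction R (a \<otimes> e \<otimes> (d \<otimes> f) \<oplus> c \<otimes> e \<otimes> (b \<otimes> f)) (b \<otimes> f \<otimes> (d \<otimes> f))"
    proof (subst fraction_eq_iff)
      show "(a \<otimes> d \<oplus> c \<otimes> b) \<otimes> e \<otimes> (b \<otimes> f \<otimes> (d \<otimes> f)) =
          (a \<otimes> e \<otimes> (d \<otimes> f) \<oplus> c \<otimes> e \<otimes> (b \<otimes> f)) \<otimes> (b \<otimes> d \<otimes> f)"
        using x(1,2) y(1,2) z(1,2) by (simp add: m_ac l_distr r_distr)
    qed (use x y z in \<open>simp_all add: integral_iff\<close>)
    also have "\<dots> = x \<otimes>\<^bsub>quot_field R\<^esub> z \<oplus>\<^bsub>quot_field R\<^esub> y \<otimes>\<^bsub>quot_field R\<^esub> z"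
      using x y z by (simp add: quot_mult quot_add integral_iff)
    finally show ?thesis .
  qed
qed

lemma quot_field_is_field: "field (quot_field R)"
proof (rule cring.cring_fieldI2[OF quot_cring])
  note s = quot_mult quot_zero quot_one fraction_eq_iff integral_iff
  show "\<zero>\<^bsub>quot_field R\<^esub> \<noteq> \<one>\<^bsub>quot_field R\<^esub>" by (simp add: s)
  show "\<exists>y\<in>carrier (quot_field R). x \<otimes>\<^bsub>quot_field R\<^esub> y = \<one>\<^bsub>quot_field R\<^esub>"
    if "x \<in> carrier (quot_field R)" "x \<noteq> \<zero>\<^bsub>quot_field R\<^esub>" for x
  proof -
    obtain a b where ab: "a \<in> carrier R" "b \<in> carrier R" "b \<noteq> \<zero>" "x = fraction R a b"
      using \<open>x \<in> carrier (quot_field R)\<close> quot_carrierE by metis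
    have "a \<noteq> \<zero>" using that(2) ab by (auto simp: s)
    then have "x \<otimes>\<^bsub>quot_field R\<^esub> fraction R b a = \<one>\<^bsub>quot_field R\<^esub>"
      using ab by (simp add: s m_comm)
    then show ?thesis using ab \<open>a \<noteq> \<zero>\<close> quot_carrierI[of b a] by blast
  qed
qed

lemma quot_field_is_quotient_field: "is_quotient_field R (quot_field R) (quot_embedding R)"
proof -
  interpret Q: field "quot_field R" by (rule quot_field_is_field)
  note s = quot_mult quot_add quot_zero quot_one fraction_eq_iff integral_iff
  have frac: "fraction R a b = quot_embedding R a \<otimes>\<^bsub>quot_field R\<^esub> inv\<^bsub>quot_field R\<^esub> quot_embedding R b"
    if "a \<in> carrier R" "b \<in> carrier R - {\<zero>}" for a b
  proof -
    have "inv\<^bsub>quot_field R\<^esub> quot_embedding R b = fraction R \<one> b"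
      using that by (intro Q.comm_inv_char) (auto simp: quot_embedding_def s intro!: quot_carrierI)
    then show ?thesis using that by (simp add: quot_embedding_def s)
  qed
  have "\<forall>x \<in> carrier (quot_field R). \<exists>a \<in> carrier R. \<exists>b \<in> carrier R - {\<zero>}.
      x = quot_embedding R a \<otimes>\<^bsub>quot_field R\<^esub> inv\<^bsub>quot_field R\<^esub> quot_embedding R b"
  proof (intro ballI)
    fix x assume "x \<in> carrier (quot_field R)"
    then obtain a b where "a \<in> carrier R" "b \<in> carrier R - {\<zero>}" "x = fraction R a b"
      by (auto simp: quot_field_def)
    with frac show "\<exists>a \<in> carrier R. \<exists>b \<in> carrier R - {\<zero>}.
      x = quot_embedding R a \<otimes>\<^bsub>quot_field R\<^esub> inv\<^bsub>quot_field R\<^esub> quot_embedding R b"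
      by blast
  qed
  moreover have "quot_embedding R \<in> ring_hom R (quot_field R)"
    by (rule ring_hom_memI) (auto simp: quot_embedding_def s intro!: quot_carrierI)
  moreover have "inj_on (quot_embedding R) (carrier R)"
    by (rule inj_onI) (simp add: quot_embedding_def s)
  ultimately show ?thesis
    using domain_axioms quot_field_is_field by (simp add: is_quotient_field_def)
qed

end

context cring
begin

lemma PIdl_eq_iff:
  assumes "a \<in> carrier R" "b \<in> carrier R"
  shows "PIdl a = PIdl b \<longleftrightarrow> a divides b \<and> b divides a"
proof -
  have sub: "PIdl a \<subseteq> PIdl b \<longleftrightarrow> b divides a" if "a \<in> carrier R" "b \<in> carrier R" for a b
    using that to_contain_is_to_divide by simp
  show ?thesis using sub[OF assms] sub[OF assms(2,1)] by blast
qed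

lemma equiv_same_ideal_rel: "equiv (nonzero_nonunits R) (same_ideal_rel R)"
  by (intro equivI refl_onI symI transI) (auto simp: same_ideal_rel_def)

lemma nonzero_nonunits_closed: "a \<in> nonzero_nonunits R \<Longrightarrow> a \<in> carrier R"
  by (simp add: nonzero_nonunits_def)

lemma ideal_class_eq_iff:
  assumes "a \<in> nonzero_nonunits R" "b \<in> nonzero_nonunits R"
  shows "ideal_class R a = ideal_class R b \<longleftrightarrow> PIdl a = PIdl b"
  using eq_equiv_class_iff[OF equiv_same_ideal_rel assms] assms
  by (simp add: ideal_class_def same_ideal_rel_def)

lemma ideal_class_in_GD_basic_iff:
  assumes "a \<in> nonzero_nonunits R" "b \<in> nonzero_nonunits R"
  shows "ideal_class R b \<in> GD_basic R a \<longleftrightarrow> (\<exists>n::nat. n \<ge> 1 \<and> b divides (a [^] n))"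
proof
  assume "ideal_class R b \<in> GD_basic R a"
  then obtain c and n :: nat where c: "c \<in> nonzero_nonunits R" "ideal_class R b = ideal_class R c"
    "n \<ge> 1" "c divides (a [^] n)"
    by (auto simp: GD_basic_def)
  then have "b divides c"
    using assms ideal_class_eq_iff PIdl_eq_iff nonzero_nonunits_closed by metis
  then show "\<exists>n::nat. n \<ge> 1 \<and> b divides (a [^] n)"
    using c divides_trans[of b c "a [^] n"] assms nonzero_nonunits_closed by blast
qed (use assms in \<open>auto simp: GD_basic_def\<close>)

lemma GD_basic_subset:
  assumes "a \<in> nonzero_nonunits R" "c \<in> nonzero_nonunits R" "ideal_class R c \<in> GD_basic R a"
  shows "GD_basic R c \<subseteq> GD_basic R a"
proof
  fix U assume "U \<in> GD_basic R c"
  then obtain b and m :: nat where b: "b \<in> nonzero_nonunits R" "U = ideal_class R b" "m \<ge> 1"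
    "b divides (c [^] m)" by (auto simp: GD_basic_def)
  obtain n :: nat where n: "n \<ge> 1" "c divides (a [^] n)"
    using assms ideal_class_in_GD_basic_iff by blast
  note cl = assms(1,2)[THEN nonzero_nonunits_closed] b(1)[THEN nonzero_nonunits_closed]
  obtain k where k: "k \<in> carrier R" "a [^] n = c \<otimes> k" using n by (auto simp: factor_def)
  have "a [^] (n * m) = (c [^] m) \<otimes> (k [^] m)"
    using cl k nat_pow_pow[of a n m] nat_pow_distrib[of c k m] by simp
  then have "(c [^] m) divides (a [^] (n * m))" using k by (auto simp: factor_def)
  then have "b divides (a [^] (n * m))" using b cl divides_trans by blast
  moreover have "n * m \<ge> 1" using n b by simp
  ultimately show "U \<in> GD_basic R a" unfolding GD_basic_def using b by blast
qed

lemma ideal_class_in_own_GD_basic: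
  assumes "a \<in> nonzero_nonunits R" shows "ideal_class R a \<in> GD_basic R a"
proof -
  have "a divides (a [^] (1::nat))" using assms nonzero_nonunits_closed by simp
  then show ?thesis unfolding ideal_class_in_GD_basic_iff[OF assms assms] by blast
qed

text \<open>The sets \<open>GD_basic R a\<close> do form a basis, so \<open>topology\<close> in the definition of \<open>GD\<close> is applied to
  an actual topology.\<close>

lemma openin_GD:
  "openin (GD R) = arbitrary union_of (\<lambda>B. B \<in> GD_basic R ` nonzero_nonunits R)"
proof -
  have "istopology (arbitrary union_of (\<lambda>B. B \<in> GD_basic R ` nonzero_nonunits R))"
    unfolding istopology_base_eq
  proof (intro allI impI)
    fix S T
    assume "S \<in> GD_basic R ` nonzero_nonunits R \<and> T \<in> GD_basic R ` nonzero_nonunits R"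
    then obtain a b where ab: "a \<in> nonzero_nonunits R" "S = GD_basic R a"
      "b \<in> nonzero_nonunits R" "T = GD_basic R b" by blast
    let ?F = "{GD_basic R c | c. c \<in> nonzero_nonunits R \<and> ideal_class R c \<in> S \<inter> T}"
    have "\<Union>?F = S \<inter> T"
    proof
      show "\<Union>?F \<subseteq> S \<inter> T" using ab GD_basic_subset by blast
      show "S \<inter> T \<subseteq> \<Union>?F"
      proof
        fix U assume U: "U \<in> S \<inter> T"
        then obtain c where c: "c \<in> nonzero_nonunits R" "U = ideal_class R c"
          using ab by (auto simp: GD_basic_def)
        then have "U \<in> GD_basic R c" using ideal_class_in_own_GD_basic by simp
        then show "U \<in> \<Union>?F" using c U by blast
      qed
    qed
    moreover have "?F \<subseteq> Collect (\<lambda>B. B \<in> GD_basic R ` nonzero_nonunits R)" by blast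
    ultimately show "(arbitrary union_of (\<lambda>B. B \<in> GD_basic R ` nonzero_nonunits R)) (S \<inter> T)"
      unfolding union_of_def arbitrary_def by blast
  qed
  then show ?thesis by (simp add: GD_def)
qed

lemma topspace_GD: "topspace (GD R) = EC R"
proof -
  have EC: "EC R = ideal_class R ` nonzero_nonunits R"
    by (auto simp: EC_def ideal_class_def quotient_def)
  have "topspace (GD R) \<subseteq> EC R"
  proof -
    have "(arbitrary union_of (\<lambda>B. B \<in> GD_basic R ` nonzero_nonunits R)) (topspace (GD R))"
      by (subst openin_GD[symmetric]) (rule openin_topspace)
    then obtain F where F: "F \<subseteq> {B. B \<in> GD_basic R ` nonzero_nonunits R}" "\<Union>F = topspace (GD R)"
      unfolding union_of_def by auto
    have sub: "GD_basic R a \<subseteq> EC R" for a unfolding EC GD_basic_def by blast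
    have "\<Union>F \<subseteq> EC R"
    proof (rule Union_least)
      fix V assume "V \<in> F"
      then obtain a where "V = GD_basic R a" using F(1) by auto
      then show "V \<subseteq> EC R" using sub by simp
    qed
    then show ?thesis using F(2) by simp
  qed
  moreover have "EC R \<subseteq> topspace (GD R)"
  proof
    fix U assume "U \<in> EC R"
    then obtain a where a: "a \<in> nonzero_nonunits R" "U = ideal_class R a" using EC by blast
    have "openin (GD R) (GD_basic R a)"
      unfolding openin_GD using a(1) by (simp add: arbitrary_def union_of_inc)
    then show "U \<in> topspace (GD R)"
      using a ideal_class_in_own_GD_basic openin_subset by blast
  qed
  ultimately show ?thesis by blast
qed

end

end

theory Submission
  imports Defs
begin

text \<open>
  All four conditions say, in different languages, that some nonzero \<open>a\<close> has the property that
  every nonzero element of \<open>R\<close> divides a power of \<open>a\<close>; such an element is called power dominant below.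

  \<^item> \<^emph>\<open>Topology.\<close> \<open>GD_basic R a = EC R\<close> is power dominance of \<open>a\<close>, read off on classes of
    associates. If it holds, every open set containing \<open>[a]\<close> contains a basic set around \<open>[a]\<close> and so
    is the whole space, which makes the space compact. Conversely the basic sets are directed, since
    \<open>B\<^sub>a \<union> B\<^sub>b \<subseteq> B\<^sub>a\<^sub>b\<close>, so a finite cover by basic sets can be
    replaced by a single one.
  \<^item> \<^emph>\<open>Prime ideals.\<close> A nonzero prime contains some \<open>x \<noteq> 0\<close>, hence a power of a power dominant
    \<open>a\<close>, hence \<open>a\<close>. Conversely, if \<open>x\<close> divides no power of \<open>a\<close>, then \<open>xR\<close> misses the powers of \<open>a\<close>
    and can be enlarged to a prime that still misses them, so \<open>a\<close> is not in every nonzero prime.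
  \<^item> \<^emph>\<open>Quotient field.\<close> If \<open>a\<close> is power dominant, then every denominator divides a power of \<open>a\<close>,
    so \<open>K = R[1/a]\<close>. Conversely, if \<open>d\<close> is a common denominator of finitely many generators of \<open>K\<close>,
    then \<open>K = R[1/d]\<close>, and writing \<open>1/x = r/d\<^sup>n\<close> shows that \<open>x\<close> divides \<open>d\<^sup>n\<close>.
\<close>

section \<open>Power dominant elements\<close>

definition power_dominant :: "('a, 'm) ring_scheme \<Rightarrow> 'a \<Rightarrow> bool" where
  "power_dominant R a \<longleftrightarrow> a \<in> carrier R - {\<zero>\<^bsub>R\<^esub>} \<and>
     (\<forall>x \<in> carrier R - {\<zero>\<^bsub>R\<^esub>}. \<exists>n::nat. x divides\<^bsub>R\<^esub> (a [^]\<^bsub>R\<^esub> n))"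

context domain
begin

lemma divides_Unit_imp_Unit:
  assumes "x \<in> carrier R" "u \<in> Units R" "x divides u"
  shows "x \<in> Units R"
  using assms by (meson divides_unit)

lemma nonfield_nonzero_nonunits_nonempty:
  assumes "\<not> field R"
  shows "nonzero_nonunits R \<noteq> {}"
proof
  assume "nonzero_nonunits R = {}"
  then have "carrier R - {\<zero>} \<subseteq> Units R" by (auto simp: nonzero_nonunits_def)
  moreover have "\<zero> \<notin> Units R"
    by (metis Units_inv_closed Units_r_inv l_null zero_not_one)
  ultimately have "Units R = carrier R - {\<zero>}" using Units_closed by blast
  then show False using assms cring_fieldI by blast
qed

text \<open>If \<open>a\<close> were a unit, its powers and hence all their divisors would be units, so \<open>R\<close> would be a
  field.\<close>

lemma power_dominant_nonunit:
  assumes "\<not> field R" "power_dominant R a"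
  shows "a \<in> nonzero_nonunits R"
proof -
  obtain x where x: "x \<in> nonzero_nonunits R"
    using nonfield_nonzero_nonunits_nonempty[OF assms(1)] by blast
  have a: "a \<in> carrier R - {\<zero>}" using assms(2) by (simp add: power_dominant_def)
  have "a \<notin> Units R"
  proof
    assume "a \<in> Units R"
    then have "a [^] n \<in> Units R" for n :: nat by (rule Units_pow_closed)
    moreover obtain n :: nat where "x divides (a [^] n)"
      using x assms(2) by (auto simp: power_dominant_def nonzero_nonunits_def)
    ultimately show False using x divides_Unit_imp_Unit by (auto simp: nonzero_nonunits_def)
  qed
  then show ?thesis using a by (simp add: nonzero_nonunits_def)
qed

section \<open>Compactness\<close>

lemma EC_eq_image: "EC R = ideal_class R ` nonzero_nonunits R"
  by (auto simp: EC_def ideal_class_def quotient_def)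

lemma GD_basic_subset_EC: "GD_basic R a \<subseteq> EC R"
  by (auto simp: EC_eq_image GD_basic_def)

text \<open>Power dominance also tests units and allows the exponent \<open>0\<close>, unlike membership in a basic set.
  The two agree because units divide \<open>a\<^sup>0\<close>, while a nonunit dividing \<open>a\<^sup>n\<close> also divides
  \<open>a\<^sup>n\<^sup>+\<^sup>1\<close>.\<close>

lemma GD_basic_eq_EC_iff:
  assumes "a \<in> nonzero_nonunits R"
  shows "GD_basic R a = EC R \<longleftrightarrow> power_dominant R a"
proof
  assume eq: "GD_basic R a = EC R"
  have "\<exists>n::nat. x divides (a [^] n)" if "x \<in> carrier R - {\<zero>}" for x
  proof (cases "x \<in> Units R")
    case True
    then have "x divides (a [^] (0::nat))" using unit_divides by simp
    then show ?thesis ..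
  next
    case False
    then have x: "x \<in> nonzero_nonunits R" using that by (simp add: nonzero_nonunits_def)
    then have "ideal_class R x \<in> GD_basic R a" unfolding eq EC_eq_image by blast
    then show ?thesis using ideal_class_in_GD_basic_iff[OF assms x] by blast
  qed
  then show "power_dominant R a"
    using assms by (auto simp: power_dominant_def nonzero_nonunits_def)
next
  assume dom: "power_dominant R a"
  have a: "a \<in> carrier R" using assms nonzero_nonunits_closed by blast
  have "ideal_class R x \<in> GD_basic R a" if x: "x \<in> nonzero_nonunits R" for x
  proof -
    obtain n :: nat where n: "x divides (a [^] n)"
      using dom x by (auto simp: power_dominant_def nonzero_nonunits_def)
    have "x divides (a [^] Suc n)"
      using divides_prod_r[OF n] a x nonzero_nonunits_closed by simp
    then show ?thesis
      unfolding ideal_class_in_GD_basic_iff[OF assms x] by (intro exI[of _ "Suc n"]) simp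
  qed
  then show "GD_basic R a = EC R" using GD_basic_subset_EC by (auto simp: EC_eq_image)
qed

lemma nonzero_nonunits_mult_closed:
  assumes "a \<in> nonzero_nonunits R" "b \<in> nonzero_nonunits R"
  shows "a \<otimes> b \<in> nonzero_nonunits R"
  using assms unit_factor[of a b] by (auto simp: nonzero_nonunits_def integral_iff)

lemma GD_basic_mono_divides:
  assumes "a \<in> nonzero_nonunits R" "c \<in> nonzero_nonunits R" "a divides c"
  shows "GD_basic R a \<subseteq> GD_basic R c"
proof -
  have "a divides (c [^] (1::nat))" using assms(2,3) nonzero_nonunits_closed by simp
  then have "ideal_class R a \<in> GD_basic R c"
    unfolding ideal_class_in_GD_basic_iff[OF assms(2,1)] by blast
  then show ?thesis using GD_basic_subset[OF assms(2,1)] by blast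
qed

text \<open>Directedness of the basis: the product of finitely many nonzero nonunits gives an upper
  bound. For the empty family any nonzero nonunit will do, and one exists because \<open>R\<close> is not a
  field.\<close>

lemma finite_GD_basic_upper_bound:
  assumes "\<not> field R" "finite A" "A \<subseteq> nonzero_nonunits R"
  shows "\<exists>c \<in> nonzero_nonunits R. \<forall>a \<in> A. GD_basic R a \<subseteq> GD_basic R c"
  using assms(2,3)
proof (induction A rule: finite_induct)
  case empty
  then show ?case using nonfield_nonzero_nonunits_nonempty[OF assms(1)] by blast
next
  case (insert b A)
  then obtain c where c: "c \<in> nonzero_nonunits R" "\<forall>a \<in> A. GD_basic R a \<subseteq> GD_basic R c"
    by blast
  have b: "b \<in> nonzero_nonunits R" using insert.prems by blast
  note bc = nonzero_nonunits_mult_closed[OF b c(1)]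
  have "b divides (b \<otimes> c)" "c divides (b \<otimes> c)"
    using b c(1) nonzero_nonunits_closed m_comm[of b c] by (metis dividesI)+
  then have "GD_basic R b \<subseteq> GD_basic R (b \<otimes> c)" "GD_basic R c \<subseteq> GD_basic R (b \<otimes> c)"
    using GD_basic_mono_divides b c(1) bc by blast+
  then show ?case using c(2) bc by blast
qed

lemma openin_GD_iff:
  "openin (GD R) U \<longleftrightarrow>
     (\<forall>x \<in> U. \<exists>a \<in> nonzero_nonunits R. x \<in> GD_basic R a \<and> GD_basic R a \<subseteq> U)"
  unfolding openin_GD arbitrary_union_of_alt by blast

lemma openin_GD_basic:
  assumes "a \<in> nonzero_nonunits R"
  shows "openin (GD R) (GD_basic R a)"
  using assms by (auto simp: openin_GD_iff)

lemma compact_space_GD_iff: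
  assumes "\<not> field R"
  shows "compact_space (GD R) \<longleftrightarrow> (\<exists>a \<in> nonzero_nonunits R. GD_basic R a = EC R)"
proof
  assume "compact_space (GD R)"
  moreover have "\<forall>U \<in> GD_basic R ` nonzero_nonunits R. openin (GD R) U"
    using openin_GD_basic by blast
  moreover have "EC R \<subseteq> \<Union>(GD_basic R ` nonzero_nonunits R)"
    using ideal_class_in_own_GD_basic by (auto simp: EC_eq_image)
  ultimately obtain F where F: "finite F" "F \<subseteq> GD_basic R ` nonzero_nonunits R" "EC R \<subseteq> \<Union>F"
    unfolding compact_space_alt topspace_GD by meson
  obtain A where A: "finite A" "A \<subseteq> nonzero_nonunits R" "F = GD_basic R ` A"
    using finite_subset_image[OF F(1,2)] by blast
  obtain c where c: "c \<in> nonzero_nonunits R" "\<forall>a \<in> A. GD_basic R a \<subseteq> GD_basic R c"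
    using finite_GD_basic_upper_bound[OF assms A(1,2)] by blast
  have "EC R \<subseteq> GD_basic R c" using F(3) A(3) c(2) by blast
  then show "\<exists>a \<in> nonzero_nonunits R. GD_basic R a = EC R"
    using c(1) GD_basic_subset_EC by blast
next
  assume "\<exists>a \<in> nonzero_nonunits R. GD_basic R a = EC R"
  then obtain a where a: "a \<in> nonzero_nonunits R" "GD_basic R a = EC R" by blast
  have mem: "ideal_class R a \<in> EC R" using a(1) by (auto simp: EC_eq_image)
  show "compact_space (GD R)"
    unfolding compact_space_alt topspace_GD
  proof (intro allI impI)
    fix C assume C: "(\<forall>U \<in> C. openin (GD R) U) \<and> EC R \<subseteq> \<Union>C"
    then obtain U where U: "U \<in> C" "ideal_class R a \<in> U" using mem by blast
    then obtain b where b: "b \<in> nonzero_nonunits R" "ideal_class R a \<in> GD_basic R b"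
      "GD_basic R b \<subseteq> U"
      using C openin_GD_iff by meson
    have "EC R \<subseteq> U" using GD_basic_subset[OF b(1) a(1) b(2)] a(2) b(3) by blast
    then show "\<exists>F. finite F \<and> F \<subseteq> C \<and> EC R \<subseteq> \<Union>F"
      using U(1) by (intro exI[of _ "{U}"]) simp
  qed
qed

end

section \<open>Nonzero prime ideals\<close>

text \<open>An ideal maximal among those missing a multiplicative set \<open>S\<close> is prime: if \<open>a\<close> and \<open>b\<close> are
  outside, both enlargements by \<open>a\<close> and by \<open>b\<close> meet \<open>S\<close>, and the product of two such meeting points
  would lie in the ideal as soon as \<open>a \<otimes> b\<close> does.\<close>

lemma (in cring) exists_primeideal_avoiding:
  assumes S: "submonoid S R" and I: "ideal I R" "I \<inter> S = {}"
  shows "\<exists>P. primeideal P R \<and> I \<subseteq> P \<and> P \<inter> S = {}"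
proof -
  define A where "A = {J. ideal J R \<and> I \<subseteq> J \<and> J \<inter> S = {}}"
  have "\<exists>M \<in> A. \<forall>J \<in> A. M \<subseteq> J \<longrightarrow> J = M"
  proof (rule subset_Zorn_nonempty)
    show "A \<noteq> {}" using I by (auto simp: A_def)
    fix C assume C: "C \<noteq> {}" "subset.chain A C"
    then have "subset.chain {J. ideal J R} C" by (auto simp: pred_on.chain_def A_def)
    then have "ideal (\<Union>C) R" using chain_Union_is_ideal[of C] C(1) by simp
    then show "\<Union>C \<in> A" using C by (auto simp: pred_on.chain_def A_def)
  qed
  then obtain M where M: "ideal M R" "I \<subseteq> M" "M \<inter> S = {}"
    and max: "\<And>J. ideal J R \<Longrightarrow> M \<subseteq> J \<Longrightarrow> J \<inter> S = {} \<Longrightarrow> J = M"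
    by (auto simp: A_def)
  interpret M: ideal M R by (rule M(1))
  have meets: "\<exists>m \<in> M. \<exists>r \<in> carrier R. m \<oplus> r \<otimes> a \<in> S" if a: "a \<in> carrier R" "a \<notin> M" for a
  proof (rule ccontr)
    assume none: "\<not> ?thesis"
    define J where "J = M <+>\<^bsub>R\<^esub> PIdl a"
    then have J_def': "J = {m \<oplus> r \<otimes> a | m r. m \<in> M \<and> r \<in> carrier R}"
      by (auto simp: set_add_def' cgenideal_def)
    have "ideal J R" unfolding J_def by (rule add_ideals[OF M(1) cgenideal_ideal[OF a(1)]])
    moreover have "M \<subseteq> J"
    proof
      fix m assume "m \<in> M"
      moreover have "m = m \<oplus> \<zero> \<otimes> a" using \<open>m \<in> M\<close> a(1) M.a_subset by auto
      ultimately show "m \<in> J" unfolding J_def' by blast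
    qed
    moreover have "J \<inter> S = {}" using none unfolding J_def' by blast
    ultimately have "J = M" by (rule max)
    moreover have "a \<in> J"
    proof -
      have "a = \<zero> \<oplus> \<one> \<otimes> a" using a(1) by simp
      then show ?thesis
        using M.zero_closed one_closed unfolding J_def' by blast
    qed
    ultimately show False using a(2) by blast
  qed
  have "primeideal M R"
  proof (rule primeidealI[OF M(1) is_cring])
    show "carrier R \<noteq> M"
      using M(3) submonoid.one_closed[OF S] by blast
    fix a b assume ab: "a \<in> carrier R" "b \<in> carrier R" "a \<otimes> b \<in> M"
    show "a \<in> M \<or> b \<in> M"
    proof (rule ccontr)
      assume "\<not> (a \<in> M \<or> b \<in> M)"
      then obtain m r m' r' where mr: "m \<in> M" "r \<in> carrier R" "m \<oplus> r \<otimes> a \<in> S"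
        "m' \<in> M" "r' \<in> carrier R" "m' \<oplus> r' \<otimes> b \<in> S"
        using meets ab(1,2) by meson
      have cl: "m \<in> carrier R" "m' \<in> carrier R" using mr M.a_subset by auto
      have "(m \<oplus> r \<otimes> a) \<otimes> (m' \<oplus> r' \<otimes> b) =
          m \<otimes> (m' \<oplus> r' \<otimes> b) \<oplus> ((r \<otimes> a) \<otimes> m' \<oplus> (r \<otimes> r') \<otimes> (a \<otimes> b))"
        using cl mr(2,5) ab(1,2) by (simp add: l_distr r_distr m_ac a_ac)
      also have "\<dots> \<in> M"
        using cl mr ab M.I_r_closed[of m "m' \<oplus> r' \<otimes> b"] M.I_l_closed[of m' "r \<otimes> a"]
          M.I_l_closed[of "a \<otimes> b" "r \<otimes> r'"]
        by simp
      finally show False using M(3) submonoid.m_closed[OF S mr(3,6)] by blast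
    qed
  qed
  then show ?thesis using M by blast
qed

lemma (in primeideal) pow_mem_imp_mem:
  assumes "a \<in> carrier R" "a [^] (n::nat) \<in> I"
  shows "a \<in> I"
  using assms(2)
proof (induction n)
  case 0
  then have "\<one> \<in> I" by simp
  then show ?case using one_imp_carrier I_notcarr by metis
next
  case (Suc n)
  then show ?case using I_prime[of "a [^] n" a] assms(1) by auto
qed

lemma (in cring) submonoid_powers:
  assumes "a \<in> carrier R"
  shows "submonoid (range (\<lambda>n::nat. a [^] n)) R"
proof
  show "range (\<lambda>n::nat. a [^] n) \<subseteq> carrier R" using assms by auto
  show "\<one> \<in> range (\<lambda>n::nat. a [^] n)" by (metis nat_pow_0 rangeI)
  fix x y assume "x \<in> range (\<lambda>n::nat. a [^] n)" "y \<in> range (\<lambda>n::nat. a [^] n)"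
  then show "x \<otimes> y \<in> range (\<lambda>n::nat. a [^] n)" using assms nat_pow_mult by auto
qed

context domain
begin

lemma power_dominant_mem_primeideal:
  assumes "power_dominant R a" "primeideal P R" "P \<noteq> {\<zero>}"
  shows "a \<in> P"
proof -
  interpret P: primeideal P R by (rule assms(2))
  obtain x where x: "x \<in> P" "x \<noteq> \<zero>" using assms(3) P.zero_closed by blast
  have cl: "a \<in> carrier R" "x \<in> carrier R"
    using assms(1) x P.a_subset by (auto simp: power_dominant_def)
  obtain n :: nat where "x divides (a [^] n)"
    using assms(1) x(2) cl(2) by (auto simp: power_dominant_def)
  then have "a [^] n \<in> P" using x(1) P.I_r_closed by (auto simp: factor_def)
  then show ?thesis using P.pow_mem_imp_mem cl(1) by blast
qed

text \<open>The prime is nonzero because it is found above \<open>xR\<close>. Taking \<open>a = \<one>\<close> and \<open>x\<close> a nonunit shows that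
  a domain which is not a field has a nonzero prime at all.\<close>

lemma exists_nonzero_primeideal_avoiding_powers:
  assumes "a \<in> carrier R" "x \<in> carrier R - {\<zero>}" "\<And>n::nat. \<not> x divides (a [^] n)"
  shows "\<exists>P. primeideal P R \<and> P \<noteq> {\<zero>} \<and> a \<notin> P"
proof -
  have "PIdl x \<inter> range (\<lambda>n::nat. a [^] n) = {}"
  proof (rule ccontr)
    assume "PIdl x \<inter> range (\<lambda>n::nat. a [^] n) \<noteq> {}"
    then obtain r and n :: nat where "r \<in> carrier R" "a [^] n = r \<otimes> x"
      by (auto simp: cgenideal_def)
    then have "a [^] n = x \<otimes> r" "r \<in> carrier R" using assms(2) m_comm by auto
    then show False using assms(3)[of n] unfolding factor_def by blast
  qed
  then obtain P where P: "primeideal P R" "PIdl x \<subseteq> P" "P \<inter> range (\<lambda>n::nat. a [^] n) = {}"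
    using exists_primeideal_avoiding[OF submonoid_powers[OF assms(1)] cgenideal_ideal[of x]] assms(2)
    by blast
  have "x \<in> P" using P(2) assms(2) cgenideal_self by blast
  moreover have "a \<notin> P" using P(3) rangeI[of "\<lambda>n::nat. a [^] n" 1] assms(1) by auto
  ultimately show ?thesis using P(1) assms(2) by blast
qed

lemma Inter_nonzero_primes_iff:
  assumes "\<not> field R"
  shows "\<Inter>{P. primeideal P R \<and> P \<noteq> {\<zero>}} \<noteq> {\<zero>} \<longleftrightarrow> (\<exists>a. power_dominant R a)"
proof (rule iffI)
  assume ne: "\<Inter>{P. primeideal P R \<and> P \<noteq> {\<zero>}} \<noteq> {\<zero>}"
  have "\<zero> \<in> P" if "primeideal P R" for P
  proof -
    interpret P: primeideal P R by (rule that)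
    show ?thesis by (rule P.zero_closed)
  qed
  then have "{\<zero>} \<subseteq> \<Inter>{P. primeideal P R \<and> P \<noteq> {\<zero>}}" by simp
  then have "{\<zero>} \<subset> \<Inter>{P. primeideal P R \<and> P \<noteq> {\<zero>}}"
    by (rule psubsetI) (rule ne[symmetric])
  then obtain a where "a \<noteq> \<zero>" "a \<in> \<Inter>{P. primeideal P R \<and> P \<noteq> {\<zero>}}"
    using psubset_imp_ex_mem by fastforce
  then have a: "a \<noteq> \<zero>" "\<And>P. primeideal P R \<Longrightarrow> P \<noteq> {\<zero>} \<Longrightarrow> a \<in> P" by simp_all
  \<comment> \<open>That \<open>a\<close> lies in \<open>R\<close> at all needs a nonzero prime: over an empty family the intersection is the
    whole type.\<close>
  obtain x where "x \<in> nonzero_nonunits R"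
    using nonfield_nonzero_nonunits_nonempty[OF assms] by blast
  then have x: "x \<in> carrier R - {\<zero>}" "x \<notin> Units R" by (simp_all add: nonzero_nonunits_def)
  have "\<not> x divides (\<one> [^] n)" for n :: nat
  proof
    assume "x divides (\<one> [^] n)"
    then have "x divides \<one>" by simp
    then show False using divides_Unit_imp_Unit[of x \<one>] x by simp
  qed
  from exists_nonzero_primeideal_avoiding_powers[OF one_closed x(1) this]
  obtain P where P: "primeideal P R" "P \<noteq> {\<zero>}" by (elim exE conjE)
  interpret P: primeideal P R by (rule P(1))
  have carr: "a \<in> carrier R" using a(2)[OF P] P.a_subset by (rule subsetD[rotated])
  have "\<exists>n::nat. y divides (a [^] n)" if y: "y \<in> carrier R - {\<zero>}" for y
  proof (rule ccontr)
    assume "\<nexists>n::nat. y divides (a [^] n)"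
    then have none: "\<not> y divides (a [^] n)" for n :: nat by simp
    from exists_nonzero_primeideal_avoiding_powers[OF carr y none]
    obtain Q where "primeideal Q R" "Q \<noteq> {\<zero>}" "a \<notin> Q" by (elim exE conjE)
    then show False using a(2)[of Q] by simp
  qed
  then have "power_dominant R a" using a(1) carr by (simp add: power_dominant_def)
  then show "\<exists>a. power_dominant R a" ..
next
  assume "\<exists>a. power_dominant R a"
  then obtain a where a: "power_dominant R a" by blast
  have "a \<in> \<Inter>{P. primeideal P R \<and> P \<noteq> {\<zero>}}"
    using power_dominant_mem_primeideal[OF a] by simp
  moreover have "a \<notin> {\<zero>}" using a by (simp add: power_dominant_def)
  ultimately show "\<Inter>{P. primeideal P R \<and> P \<noteq> {\<zero>}} \<noteq> {\<zero>}" by metis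
qed

end

section \<open>Finite generation of the quotient field\<close>

locale quotient_field_ext = R?: domain R + K: field K
  for R :: "('a, 'm) ring_scheme" (structure) and K :: "('k, 'n) ring_scheme" and \<iota> :: "'a \<Rightarrow> 'k" +
  assumes hom: "\<iota> \<in> ring_hom R K"
    and inj: "inj_on \<iota> (carrier R)"
    and fractions: "x \<in> carrier K \<Longrightarrow>
      \<exists>a \<in> carrier R. \<exists>b \<in> carrier R - {\<zero>}. x = \<iota> a \<otimes>\<^bsub>K\<^esub> inv\<^bsub>K\<^esub> (\<iota> b)"
begin

sublocale h: ring_hom_cring R K \<iota>
  by unfold_locales (rule hom)

lemma \<iota>_nonzero_Unit:
  assumes "a \<in> carrier R - {\<zero>}"
  shows "\<iota> a \<in> Units K"
  using assms inj_onD[OF inj, of a \<zero>] by (auto simp: K.field_Units)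

text \<open>For nonzero \<open>d\<close> this is the subring \<open>R[1/d]\<close>, described by clearing denominators.\<close>

definition localization :: "'a \<Rightarrow> 'k set" where
  "localization d = {x \<in> carrier K. \<exists>n::nat. x \<otimes>\<^bsub>K\<^esub> \<iota> (d [^] n) \<in> \<iota> ` carrier R}"

lemma localizationI:
  assumes "x \<in> carrier K" "r \<in> carrier R" "x \<otimes>\<^bsub>K\<^esub> \<iota> (d [^] (n::nat)) = \<iota> r"
  shows "x \<in> localization d"
  using assms by (auto simp: localization_def)

lemma image_subset_localization: "d \<in> carrier R \<Longrightarrow> \<iota> ` carrier R \<subseteq> localization d"
proof
  fix x assume "d \<in> carrier R" "x \<in> \<iota> ` carrier R"
  then obtain r where r: "r \<in> carrier R" "x = \<iota> r" by blast
  then have "x \<otimes>\<^bsub>K\<^esub> \<iota> (d [^] (0::nat)) = \<iota> r" by simp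
  then show "x \<in> localization d" using r by (intro localizationI[of x r d 0]) auto
qed

lemma subring_localization:
  assumes d: "d \<in> carrier R"
  shows "subring (localization d) K"
proof (rule K.subringI)
  show "localization d \<subseteq> carrier K" by (auto simp: localization_def)
  show "\<one>\<^bsub>K\<^esub> \<in> localization d"
    using image_subset_localization[OF d] h.hom_one R.one_closed by (metis image_subset_iff)
  show "\<ominus>\<^bsub>K\<^esub> x \<in> localization d" if x: "x \<in> localization d" for x
  proof -
    obtain r and n :: nat where r: "x \<in> carrier K" "r \<in> carrier R" "x \<otimes>\<^bsub>K\<^esub> \<iota> (d [^] n) = \<iota> r"
      using x by (auto simp: localization_def)
    have "\<ominus>\<^bsub>K\<^esub> x \<otimes>\<^bsub>K\<^esub> \<iota> (d [^] n) = \<iota> (\<ominus> r)"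
      using r d by (simp add: K.l_minus)
    then show ?thesis using r(1,2) by (intro localizationI[of _ "\<ominus> r" d n]) auto
  qed
  fix x y assume "x \<in> localization d" "y \<in> localization d"
  then obtain r s and m n :: nat where
    r: "x \<in> carrier K" "r \<in> carrier R" "x \<otimes>\<^bsub>K\<^esub> \<iota> (d [^] m) = \<iota> r" and
    s: "y \<in> carrier K" "s \<in> carrier R" "y \<otimes>\<^bsub>K\<^esub> \<iota> (d [^] n) = \<iota> s"
    by (auto simp: localization_def)
  have split: "\<iota> (d [^] (m + n)) = \<iota> (d [^] m) \<otimes>\<^bsub>K\<^esub> \<iota> (d [^] n)"
    using d by (simp flip: R.nat_pow_mult)
  have dcl: "\<iota> (d [^] m) \<in> carrier K" "\<iota> (d [^] n) \<in> carrier K" using d by auto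
  have "x \<otimes>\<^bsub>K\<^esub> y \<otimes>\<^bsub>K\<^esub> \<iota> (d [^] (m + n)) = (x \<otimes>\<^bsub>K\<^esub> \<iota> (d [^] m)) \<otimes>\<^bsub>K\<^esub> (y \<otimes>\<^bsub>K\<^esub> \<iota> (d [^] n))"
    unfolding split using r(1) s(1) dcl by (simp add: K.m_ac)
  also have "\<dots> = \<iota> (r \<otimes> s)" using r s by simp
  finally show "x \<otimes>\<^bsub>K\<^esub> y \<in> localization d"
    using r s by (intro localizationI[of _ "r \<otimes> s" d "m + n"]) auto
  have "(x \<oplus>\<^bsub>K\<^esub> y) \<otimes>\<^bsub>K\<^esub> \<iota> (d [^] (m + n)) =
      (x \<otimes>\<^bsub>K\<^esub> \<iota> (d [^] m)) \<otimes>\<^bsub>K\<^esub> \<iota> (d [^] n) \<oplus>\<^bsub>K\<^esub> (y \<otimes>\<^bsub>K\<^esub> \<iota> (d [^] n)) \<otimes>\<^bsub>K\<^esub> \<iota> (d [^] m)"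
    unfolding split using r(1) s(1) dcl by (simp add: K.m_ac K.l_distr)
  also have "\<dots> = \<iota> (r \<otimes> (d [^] n) \<oplus> s \<otimes> (d [^] m))" using r s d by simp
  finally show "x \<oplus>\<^bsub>K\<^esub> y \<in> localization d"
    using r s d by (intro localizationI[of _ "r \<otimes> (d [^] n) \<oplus> s \<otimes> (d [^] m)" d "m + n"]) auto
qed

lemma localization_mono_mult:
  assumes "d \<in> carrier R" "e \<in> carrier R"
  shows "localization d \<subseteq> localization (d \<otimes> e)"
proof
  fix x assume "x \<in> localization d"
  then obtain r and n :: nat where r: "x \<in> carrier K" "r \<in> carrier R" "x \<otimes>\<^bsub>K\<^esub> \<iota> (d [^] n) = \<iota> r"
    by (auto simp: localization_def)
  have "x \<otimes>\<^bsub>K\<^esub> \<iota> ((d \<otimes> e) [^] n) = (x \<otimes>\<^bsub>K\<^esub> \<iota> (d [^] n)) \<otimes>\<^bsub>K\<^esub> \<iota> (e [^] n)"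
    using assms r(1) by (simp add: R.nat_pow_distrib K.m_assoc)
  also have "\<dots> = \<iota> (r \<otimes> e [^] n)" using r assms by simp
  finally show "x \<in> localization (d \<otimes> e)"
    using r assms by (intro localizationI[of _ "r \<otimes> e [^] n" "d \<otimes> e" n]) auto
qed

text \<open>The element \<open>d\<close> is a common denominator, the product of the denominators of the elements of
  \<open>S\<close>.\<close>

lemma finite_subset_localization:
  assumes "finite S" "S \<subseteq> carrier K"
  shows "\<exists>d \<in> carrier R - {\<zero>}. S \<subseteq> localization d"
  using assms
proof (induction S rule: finite_induct)
  case empty
  show ?case by (intro bexI[of _ \<one>]) auto
next
  case (insert x S)
  then obtain d where d: "d \<in> carrier R - {\<zero>}" "S \<subseteq> localization d" by blast
  obtain a b where ab: "a \<in> carrier R" "b \<in> carrier R - {\<zero>}" "x = \<iota> a \<otimes>\<^bsub>K\<^esub> inv\<^bsub>K\<^esub> (\<iota> b)"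
    using fractions insert.prems by blast
  have "x \<otimes>\<^bsub>K\<^esub> \<iota> (b [^] (1::nat)) = \<iota> a"
    using ab \<iota>_nonzero_Unit[OF ab(2)] by (simp add: K.m_assoc)
  then have "x \<in> localization b" using ab insert.prems by (intro localizationI[of x a b 1]) auto
  then have "x \<in> localization (d \<otimes> b)"
    using localization_mono_mult[of b d] d ab by (auto simp: R.m_comm)
  moreover have "S \<subseteq> localization (d \<otimes> b)"
    using localization_mono_mult[of d b] d ab by blast
  moreover have "d \<otimes> b \<in> carrier R - {\<zero>}" using d ab by (auto simp: R.integral_iff)
  ultimately show ?case by blast
qed

lemma power_dominant_if_localization_all:
  assumes d: "d \<in> carrier R - {\<zero>}" and all: "carrier K \<subseteq> localization d"
  shows "power_dominant R d"
proof -
  have "\<exists>n::nat. x divides (d [^] n)" if x: "x \<in> carrier R - {\<zero>}" for x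
  proof -
    have inv: "inv\<^bsub>K\<^esub> (\<iota> x) \<in> carrier K" using \<iota>_nonzero_Unit[OF x] by simp
    then obtain r and n :: nat where
      r: "r \<in> carrier R" "inv\<^bsub>K\<^esub> (\<iota> x) \<otimes>\<^bsub>K\<^esub> \<iota> (d [^] n) = \<iota> r"
      using all by (auto simp: localization_def)
    have "\<iota> (x \<otimes> r) = \<iota> x \<otimes>\<^bsub>K\<^esub> (inv\<^bsub>K\<^esub> (\<iota> x) \<otimes>\<^bsub>K\<^esub> \<iota> (d [^] n))" using x r by simp
    also have "\<dots> = \<iota> (d [^] n)"
      using x d inv \<iota>_nonzero_Unit[OF x] by (simp flip: K.m_assoc)
    finally have "x \<otimes> r = d [^] n" using inj_onD[OF inj] x r(1) d by auto
    then show ?thesis using r(1) unfolding factor_def by metis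
  qed
  then show ?thesis using d by (simp add: power_dominant_def)
qed

lemma power_dominant_generates:
  assumes a: "power_dominant R a"
  shows "generate_ring K (\<iota> ` carrier R \<union> {inv\<^bsub>K\<^esub> (\<iota> a)}) = carrier K"
    (is "?G = _")
proof
  have a': "a \<in> carrier R - {\<zero>}" using a by (simp add: power_dominant_def)
  note au = \<iota>_nonzero_Unit[OF a']
  have gens: "\<iota> ` carrier R \<union> {inv\<^bsub>K\<^esub> (\<iota> a)} \<subseteq> carrier K" using au by auto
  then show "?G \<subseteq> carrier K" by (rule K.generate_ring_incl)
  show "carrier K \<subseteq> ?G"
  proof
    fix x assume "x \<in> carrier K"
    then obtain b c where bc: "b \<in> carrier R" "c \<in> carrier R - {\<zero>}"
      "x = \<iota> b \<otimes>\<^bsub>K\<^esub> inv\<^bsub>K\<^esub> (\<iota> c)"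
      using fractions by blast
    note cu = \<iota>_nonzero_Unit[OF bc(2)]
    obtain n :: nat where "c divides (a [^] n)" using a bc(2) by (auto simp: power_dominant_def)
    then obtain k where k: "k \<in> carrier R" "a [^] n = c \<otimes> k" by (auto simp: factor_def)
    let ?u = "inv\<^bsub>K\<^esub> (\<iota> a) [^]\<^bsub>K\<^esub> n"
    have u: "?u \<in> carrier K" using au by simp
    have "\<iota> c \<otimes>\<^bsub>K\<^esub> (\<iota> k \<otimes>\<^bsub>K\<^esub> ?u) = \<iota> (a [^] n) \<otimes>\<^bsub>K\<^esub> ?u"
      using k bc(2) u by (simp add: K.m_assoc)
    also have "\<dots> = (\<iota> a \<otimes>\<^bsub>K\<^esub> inv\<^bsub>K\<^esub> (\<iota> a)) [^]\<^bsub>K\<^esub> n"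
      using a' au by (simp add: K.nat_pow_distrib del: K.Units_r_inv)
    also have "\<dots> = \<one>\<^bsub>K\<^esub>" using au by simp
    \<comment> \<open>From \<open>a\<^sup>n = c k\<close> it follows that \<open>1/c = k (1/a)\<^sup>n\<close>.\<close>
    finally have "inv\<^bsub>K\<^esub> (\<iota> c) = \<iota> k \<otimes>\<^bsub>K\<^esub> ?u"
      using k(1) u bc(2) by (intro K.comm_inv_char) auto
    then have x: "x = \<iota> b \<otimes>\<^bsub>K\<^esub> (\<iota> k \<otimes>\<^bsub>K\<^esub> ?u)" using bc(3) by simp
    have "?u \<in> ?G"
      by (induction n) (auto intro: generate_ring.one generate_ring.eng_mult generate_ring.incl)
    moreover have "\<iota> b \<in> ?G" "\<iota> k \<in> ?G" using bc(1) k(1) by (auto intro: generate_ring.incl)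
    ultimately show "x \<in> ?G" unfolding x by (intro generate_ring.eng_mult)
  qed
qed

lemma finitely_generated_algebra_iff:
  "finitely_generated_algebra R K \<iota> \<longleftrightarrow> (\<exists>a. power_dominant R a)"
proof
  assume "finitely_generated_algebra R K \<iota>"
  then obtain S where S: "finite S" "S \<subseteq> carrier K"
    "generate_ring K (\<iota> ` carrier R \<union> S) = carrier K"
    by (auto simp: finitely_generated_algebra_def)
  obtain d where d: "d \<in> carrier R - {\<zero>}" "S \<subseteq> localization d"
    using finite_subset_localization[OF S(1,2)] by blast
  have "generate_ring K (\<iota> ` carrier R \<union> S) \<subseteq> localization d"
    using d S(2) image_subset_localization[of d]
    by (intro K.generate_ring_min_subring1 subring_localization) auto
  then show "\<exists>a. power_dominant R a"
    using power_dominant_if_localization_all[OF d(1)] S(3) by blast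
next
  assume "\<exists>a. power_dominant R a"
  then obtain a where a: "power_dominant R a" by blast
  have "inv\<^bsub>K\<^esub> (\<iota> a) \<in> carrier K" using a \<iota>_nonzero_Unit[of a] by (simp add: power_dominant_def)
  then show "finitely_generated_algebra R K \<iota>"
    unfolding finitely_generated_algebra_def
    using power_dominant_generates[OF a] by (intro exI[of _ "{inv\<^bsub>K\<^esub> (\<iota> a)}"]) simp
qed

end

lemma is_quotient_field_imp_ext:
  assumes "is_quotient_field R K \<iota>"
  shows "quotient_field_ext R K \<iota>"
  using assms
  by (auto simp: is_quotient_field_def quotient_field_ext_def quotient_field_ext_axioms_def)

section \<open>The equivalence\<close>

theorem theorem4p4:
  fixes R :: "('a, 'm) ring_scheme" and K :: "('k, 'n) ring_scheme" and \<iota> :: "'a \<Rightarrow> 'k"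
  assumes "domain R" and "\<not> field R" and "is_quotient_field R K \<iota>"
  shows "(compact_space (GD R) \<longleftrightarrow> (\<exists>a \<in> nonzero_nonunits R. GD_basic R a = EC R)) \<and>
    ((\<exists>a \<in> nonzero_nonunits R. GD_basic R a = EC R) \<longleftrightarrow>
       \<Inter>{P. primeideal P R \<and> P \<noteq> {\<zero>\<^bsub>R\<^esub>}} \<noteq> {\<zero>\<^bsub>R\<^esub>}) \<and>
    (\<Inter>{P. primeideal P R \<and> P \<noteq> {\<zero>\<^bsub>R\<^esub>}} \<noteq> {\<zero>\<^bsub>R\<^esub>} \<longleftrightarrow>
       finitely_generated_algebra R K \<iota>) \<and>
    (finitely_generated_algebra R K \<iota> \<longleftrightarrow> G_domain R)"
proof -
  interpret domain R by (rule assms(1))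
  interpret K: quotient_field_ext R K \<iota> by (rule is_quotient_field_imp_ext[OF assms(3)])
  interpret Q: quotient_field_ext R "quot_field R" "quot_embedding R"
    by (rule is_quotient_field_imp_ext[OF quot_field_is_quotient_field])
  have basic: "(\<exists>a \<in> nonzero_nonunits R. GD_basic R a = EC R) \<longleftrightarrow> (\<exists>a. power_dominant R a)"
    using GD_basic_eq_EC_iff power_dominant_nonunit[OF assms(2)] by blast
  have G: "G_domain R \<longleftrightarrow> (\<exists>a. power_dominant R a)"
    using assms(1,2) Q.finitely_generated_algebra_iff by (simp add: G_domain_def)
  show ?thesis
    by (simp only: compact_space_GD_iff[OF assms(2)] Inter_nonzero_primes_iff[OF assms(2)]
        K.finitely_generated_algebra_iff basic G simp_thms)
qed

end
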